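(* Consider a quadcopter with state $\Gamma=(b,R,v,\Omega)$ on $TQ$, $Q=SE(3)\cong\mathbb R^3\times SO(3)$, and rotor speeds $\omega_1,\dots,\omega_4$, whose equations of motion are $$\dot b=Rv,\qquad \dot R=R\hat\Omega,\qquad m\dot v=mv\times\Omega+f_1+f_2+f_3,\qquad J\dot\Omega=J\Omega\times\Omega+\tau_f+\tau_1+\tau_2,$$ with the forces and torques $f_1,f_2,f_3,\tau_f,\tau_1,\tau_2$ defined in the context. Ignore gyroscopic effects, i.e. replace $\tau_2$ by $0$, and set $u_i=\omega_i^2$ for $i=1,2,3,4$. Then the equations of motion can be expressed as the affine nonlinear control system $$\dot\Gamma=f(\Gamma)+\sum_{i=1}^4 g_i(\Gamma)\,u_i,$$ where (in the component convention described in the context) the drift vector field is $$f(\Gamma)=\begin{pmatrix} v\\ \Omega\\ v\times\Omega+m^{-1}f_1+m^{-1}f_2\\ J^{-1}(J\Omega\times\Omega)+J^{-1}\tau_1\end{pmatrix}$$ and the control vector fields are $$g_1=\begin{pmatrix}0\\0\\(0,0,m^{-1}K_r)^t\\ J^{-1}(-K_rd,0,K_d)^t\end{pmatrix},\quad g_2=\begin{pmatrix}0\\0\\(0,0,m^{-1}K_r)^t\\ J^{-1}(0,-K_rd,-K_d)^t\end{pmatrix},$$ $$g_3=\begin{pmatrix}0\\0\\(0,0,m^{-1}K_r)^t\\ J^{-1}(K_rd,0,K_d)^t\end{pmatrix},\quad g_4=\begin{pmatrix}0\\0\\(0,0,m^{-1}K_r)^t\\ J^{-1}(0,K_rd,-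K_d)^t\end{pmatrix}.$$
   Context: Here $b\in\mathbb R^3$ is the position of the center of mass in an inertial frame, $R\in SO(3)$ the orientation, and $v,\Omega\in\mathbb R^3$ the translational and angular velocities in the body frame. The hat map is defined by $\hat y z=y\times z$ for $y,z\in\mathbb R^3$. Constants: mass $m>0$; inertia tensor $J=\mathrm{diag}(J_1,J_2,J_3)$ with $J_k>0$; gravitational constant $g>0$; thrust coefficient $K_r>0$; propeller drag coefficient $K_d>0$; distance $d>0$ from the center of mass to each rotor axis; translational and rotational drag vectors $C_D,C_\tau\in\mathbb R^3$; rotor inertia $J_r=\mathrm{diag}(0,0,\bar J_r)$. Let $e_3=(0,0,1)^t$. The forces and torques, in the body frame, are - $f_1=-\mathrm{diag}(v_1|v_1|,v_2|v_2|,v_3|v_3|)\,C_D$ (drag); - $f_2=-mgR^te_3$ (gravity); - $f_3=\sum_{i=1}^4K_r\omega_i^2\,e_3$ (thrust); - $\tau_f=\big(K_rd(\omega_3^2-\omega_1^2),\;K_rd(\omega_4^2-\omega_2^2),\;K_d\sum_{i=1}^4(-1)^{i+1}\omega_i^2\big)^t$ (torque generated by rotors); - $\tau_1=-\mathrm{diag}(\Omega_1|\Omega_1|,\Omega_2|\Omega_2|,\Omega_3|\Omega_3|)\,C_\tau$ (rotational drag); - $\tau_2=\sum_{i=1}^4\Omega\times(-1)^{i+1}J_r(0,0,\omega_i)^t$ (gyroscopic torque). Component convention: a column $(a,c,\alpha,\beta)^t$ with $a,c,\alpha,\beta\in\mathbb R^3$, representing a tangent vector to $TQ$ at $(b,R,v,\Omega)$,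 has its first two blocks expressed in the left-invariant frame of $SE(3)$ given by $(Re_i,0)$ and $(0,R\hat e_j)$; that is, $\dot\Gamma=(a,c,\alpha,\beta)^t$ means $\dot b=Ra$, $\dot R=R\hat c$, $\dot v=\alpha$, $\dot\Omega=\beta$. *)

theory Defs
  imports "HOL-Analysis.Analysis"
begin

type_synonym R3 = "real^3"

text \<open>A state \<open>(b, R, v, \<Omega>)\<close>; the manifold \<open>TQ\<close> is the subset \<open>phase_space\<close> below.\<close>

type_synonym state = "R3 \<times> (real^3^3) \<times> R3 \<times> R3"

text \<open>A column \<open>(a, c, \<alpha>, \<beta>)\<close> of components of a tangent vector in the left-invariant frame.\<close>

type_synonym components = "R3 \<times> R3 \<times> R3 \<times> R3"

definition phase_space :: "state set" where
  "phase_space = {(b, R, v, \<Omega>). rotation_matrix R}"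

definition diag_matrix :: "real^'n \<Rightarrow> real^'n^'n" where
  "diag_matrix x = (\<chi> i j. if i = j then x $ i else 0)"

definition hat :: "R3 \<Rightarrow> real^3^3" where
  "hat y = matrix (cross3 y)"

lemma hat_mult_vec: "hat y *v z = cross3 y z"
  unfolding hat_def
  using bilinear_cross by (simp add: bilinear_def matrix_works)

record quadcopter =
  mass :: real
  inertia :: R3  \<comment> \<open>diagonal \<open>(J\<^sub>1, J\<^sub>2, J\<^sub>3)\<close> of the inertia tensor\<close>
  grav :: real
  thrust_coeff :: real  \<comment> \<open>\<open>K\<^sub>r\<close>\<close>
  prop_drag_coeff :: real  \<comment> \<open>\<open>K\<^sub>d\<close>\<close>
  arm_length :: real  \<comment> \<open>\<open>d\<close>\<close>
  drag_vec :: R3  \<comment> \<open>\<open>C\<^sub>D\<close>\<close>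
  rot_drag_vec :: R3  \<comment> \<open>\<open>C\<^sub>\<tau>\<close>\<close>
  rotor_inertia :: real  \<comment> \<open>axial entry of \<open>J\<^sub>r = diag (0, 0, _)\<close>\<close>

definition admissible :: "quadcopter \<Rightarrow> bool" where
  "admissible P \<longleftrightarrow>
     mass P > 0 \<and> (\<forall>k. inertia P $ k > 0) \<and> grav P > 0 \<and>
     thrust_coeff P > 0 \<and> prop_drag_coeff P > 0 \<and> arm_length P > 0"

definition inertia_tensor :: "quadcopter \<Rightarrow> real^3^3" where
  "inertia_tensor P = diag_matrix (inertia P)"

definition rotor_inertia_tensor :: "quadcopter \<Rightarrow> real^3^3" where
  "rotor_inertia_tensor P = diag_matrix (vector [0, 0, rotor_inertia P])"

text \<open>The rotor speeds are \<open>\<omega> 1, \<dots>, \<omega> 4\<close>; values of \<open>\<omega>\<close> at other indices play no role.\<close>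

definition drag_force :: "quadcopter \<Rightarrow> R3 \<Rightarrow> R3" where
  "drag_force P v = - (diag_matrix (\<chi> k. v $ k * \<bar>v $ k\<bar>) *v drag_vec P)"

definition gravity_force :: "quadcopter \<Rightarrow> real^3^3 \<Rightarrow> R3" where
  "gravity_force P R = - ((mass P * grav P) *\<^sub>R (transpose R *v vector [0, 0, 1]))"

definition thrust_force :: "quadcopter \<Rightarrow> (nat \<Rightarrow> real) \<Rightarrow> R3" where
  "thrust_force P \<omega> = (\<Sum>i = 1..4. thrust_coeff P * (\<omega> i)\<^sup>2) *\<^sub>R vector [0, 0, 1]"

definition rotor_torque :: "quadcopter \<Rightarrow> (nat \<Rightarrow> real) \<Rightarrow> R3" where
  "rotor_torque P \<omega> = vector
     [thrust_coeff P * arm_length P * ((\<omega> 3)\<^sup>2 - (\<omega> 1)\<^sup>2),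
      thrust_coeff P * arm_length P * ((\<omega> 4)\<^sup>2 - (\<omega> 2)\<^sup>2),
      prop_drag_coeff P * (\<Sum>i = 1..4. (- 1) ^ (i + 1) * (\<omega> i)\<^sup>2)]"

definition drag_torque :: "quadcopter \<Rightarrow> R3 \<Rightarrow> R3" where
  "drag_torque P \<Omega> = - (diag_matrix (\<chi> k. \<Omega> $ k * \<bar>\<Omega> $ k\<bar>) *v rot_drag_vec P)"

definition gyroscopic_torque :: "quadcopter \<Rightarrow> R3 \<Rightarrow> (nat \<Rightarrow> real) \<Rightarrow> R3" where
  "gyroscopic_torque P \<Omega> \<omega> =
     (\<Sum>i = 1..4. cross3 \<Omega>
        ((- 1) ^ (i + 1) *\<^sub>R (rotor_inertia_tensor P *v vector [0, 0, \<omega> i])))"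

text \<open>The argument \<open>\<tau>\<^sub>2\<close> is the gyroscopic torque law, so that the full model and the one
  without gyroscopic effects are instances of the same equations. Derivatives are taken at \<open>t\<close>
  within the time domain \<open>T\<close>.\<close>

definition motion_eqs_at ::
  "quadcopter \<Rightarrow> (R3 \<Rightarrow> (nat \<Rightarrow> real) \<Rightarrow> R3) \<Rightarrow> real set \<Rightarrow>
   (real \<Rightarrow> R3) \<Rightarrow> (real \<Rightarrow> real^3^3) \<Rightarrow> (real \<Rightarrow> R3) \<Rightarrow> (real \<Rightarrow> R3) \<Rightarrow>
   (nat \<Rightarrow> real \<Rightarrow> real) \<Rightarrow> real \<Rightarrow> bool" where
  "motion_eqs_at P \<tau>\<^sub>2 T b R v \<Omega> \<omega> t \<longleftrightarrow>
     (b has_vector_derivative R t *v v t) (at t within T) \<and>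
     (R has_vector_derivative R t ** hat (\<Omega> t)) (at t within T) \<and>
     (\<exists>v'. (v has_vector_derivative v') (at t within T) \<and>
        mass P *\<^sub>R v' =
          cross3 (mass P *\<^sub>R v t) (\<Omega> t) + drag_force P (v t) + gravity_force P (R t)
          + thrust_force P (\<lambda>i. \<omega> i t)) \<and>
     (\<exists>\<Omega>'. (\<Omega> has_vector_derivative \<Omega>') (at t within T) \<and>
        inertia_tensor P *v \<Omega>' =
          cross3 (inertia_tensor P *v \<Omega> t) (\<Omega> t) + rotor_torque P (\<lambda>i. \<omega> i t)
          + drag_torque P (\<Omega> t) + \<tau>\<^sub>2 (\<Omega> t) (\<lambda>i. \<omega> i t))"

abbreviation full_motion_eqs_at where
  "full_motion_eqs_at P \<equiv> motion_eqs_at P (gyroscopic_torque P)"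

abbreviation no_gyro_motion_eqs_at where
  "no_gyro_motion_eqs_at P \<equiv> motion_eqs_at P (\<lambda>_ _. 0)"

fun tangent_of :: "state \<Rightarrow> components \<Rightarrow> state" where
  "tangent_of (b, R, v, \<Omega>) (a, c, \<alpha>, \<beta>) = (R *v a, R ** hat c, \<alpha>, \<beta>)"

text \<open>The system \<open>\<Gamma>' = F \<Gamma> + (\<Sum>i = 1..4. u i *\<^sub>R G i \<Gamma>)\<close>, the vector fields being given
  by their components.\<close>

definition affine_control_system_at ::
  "(state \<Rightarrow> components) \<Rightarrow> (nat \<Rightarrow> state \<Rightarrow> components) \<Rightarrow> real set \<Rightarrow>
   (real \<Rightarrow> state) \<Rightarrow> (nat \<Rightarrow> real \<Rightarrow> real) \<Rightarrow> real \<Rightarrow> bool" where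
  "affine_control_system_at F G T \<Gamma> u t \<longleftrightarrow>
     (\<Gamma> has_vector_derivative
        tangent_of (\<Gamma> t) (F (\<Gamma> t) + (\<Sum>i = 1..4. u i t *\<^sub>R G i (\<Gamma> t)))) (at t within T)"

fun drift_field :: "quadcopter \<Rightarrow> state \<Rightarrow> components" where
  "drift_field P (b, R, v, \<Omega>) =
     (v,
      \<Omega>,
      cross3 v \<Omega> + inverse (mass P) *\<^sub>R drag_force P v + inverse (mass P) *\<^sub>R gravity_force P R,
      matrix_inv (inertia_tensor P) *v cross3 (inertia_tensor P *v \<Omega>) \<Omega>
      + matrix_inv (inertia_tensor P) *v drag_torque P \<Omega>)"

text \<open>Only the indices 1 to 4 are meaningful below.\<close>

definition control_torque :: "quadcopter \<Rightarrow> nat \<Rightarrow> R3" where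
  "control_torque P i =
     (if i = 1 then vector [- (thrust_coeff P * arm_length P), 0, prop_drag_coeff P]
      else if i = 2 then vector [0, - (thrust_coeff P * arm_length P), - prop_drag_coeff P]
      else if i = 3 then vector [thrust_coeff P * arm_length P, 0, prop_drag_coeff P]
      else if i = 4 then vector [0, thrust_coeff P * arm_length P, - prop_drag_coeff P]
      else 0)"

definition control_field :: "quadcopter \<Rightarrow> nat \<Rightarrow> state \<Rightarrow> components" where
  "control_field P i \<Gamma> =
     (0,
      0,
      vector [0, 0, inverse (mass P) * thrust_coeff P],
      matrix_inv (inertia_tensor P) *v control_torque P i)"

end

theory Submission
  imports Defs
begin

text \<open>The equivalence holds separately at each time. In the left-invariant frame the kinematic
  equations are already the first two blocks. Newton's equation can be divided by the nonzero mass,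
  and Euler's multiplied by the inverse of the inertia tensor, which exists because that tensor is
  diagonal with positive entries (\<open>invertible_diag_matrix\<close>,
  \<open>matrix_vector_mult_eq_iff\<close>). The rotor speeds then enter only through thrust and
  rotor torque, both linear in the squares of the speeds; collecting the coefficient of each square
  gives the control fields (\<open>thrust_force_eq_sum\<close>, \<open>rotor_torque_eq_sum\<close>).
  What cannot depend on the inputs is the drift.\<close>

lemma has_vector_derivative_Pair_iff:
  "((\<lambda>s. (f s, g s)) has_vector_derivative (f', g')) (at x within S) \<longleftrightarrow>
     (f has_vector_derivative f') (at x within S) \<and>
     (g has_vector_derivative g') (at x within S)"
  (is "?fg \<longleftrightarrow> ?f \<and> ?g")
proof
  assume ?fg
  note * = this [unfolded has_vector_derivative_def]
  from has_derivative_fst [OF *] has_derivative_snd [OF *] show "?f \<and> ?g"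
    by (simp add: has_vector_derivative_def)
qed (simp add: has_vector_derivative_Pair)

lemma diag_matrix_mult:
  fixes x y :: "real^'n"
  shows "diag_matrix x ** diag_matrix y = diag_matrix (\<chi> i. x $ i * y $ i)"
proof -
  \<comment> \<open>Nesting the two case distinctions with \<open>i = k\<close> outermost leaves a
    single nonzero term in the sum over \<open>k\<close>.\<close>
  have "(if i = k then x $ i else 0) * (if k = j then y $ k else 0) =
      (if i = k then if i = j then x $ i * y $ i else 0 else 0)" for i j k
    by simp
  then show ?thesis
    by (simp add: vec_eq_iff matrix_matrix_mult_def diag_matrix_def)
qed

lemma invertible_diag_matrix:
  fixes x :: "real^'n"
  assumes "\<And>i. x $ i \<noteq> 0"
  shows "invertible (diag_matrix x)"
proof -
  have "diag_matrix x ** diag_matrix (\<chi> i. inverse (x $ i)) = mat 1"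
    "diag_matrix (\<chi> i. inverse (x $ i)) ** diag_matrix x = mat 1"
    using assms by (simp_all add: diag_matrix_mult) (simp_all add: diag_matrix_def mat_def vec_eq_iff)
  then show ?thesis
    unfolding invertible_def by blast
qed

lemma matrix_vector_mult_eq_iff:
  fixes A :: "real^'n^'n"
  assumes "invertible A"
  shows "A *v x = y \<longleftrightarrow> x = matrix_inv A *v y"
proof -
  \<comment> \<open>\<open>matrix_inv\<close> is a Hilbert choice; invertibility supplies the
    witness that makes it a two-sided inverse.\<close>
  have "A ** matrix_inv A = mat 1 \<and> matrix_inv A ** A = mat 1"
    using assms unfolding invertible_def matrix_inv_def by (rule someI_ex)
  then show ?thesis
    by (auto simp: matrix_vector_mul_assoc)
qed

text \<open>All rotors push along the same body axis, so the four control fields share one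
  translational block.\<close>

lemma thrust_force_eq_sum:
  "inverse (mass P) *\<^sub>R thrust_force P w =
     (\<Sum>i = 1..4. (w i)\<^sup>2 *\<^sub>R vector [0, 0, inverse (mass P) * thrust_coeff P])"
  unfolding thrust_force_def scaleR_left.sum [symmetric]
  unfolding vec_eq_iff forall_3 sum_distrib_left [symmetric]
  by simp

lemma rotor_torque_eq_sum:
  "rotor_torque P w = (\<Sum>i = 1..4. (w i)\<^sup>2 *\<^sub>R control_torque P i)"
proof -
  \<comment> \<open>Polymorphic, as it expands both the real sum inside \<open>rotor_torque\<close>
    and the vector sum on the right.\<close>
  have *: "(\<Sum>i = 1..4. h i) = h 1 + h 2 + h 3 + h 4" for h :: "nat \<Rightarrow> 'a::comm_monoid_add"
    by (simp add: numeral_eq_Suc ac_simps)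
  show ?thesis
    unfolding rotor_torque_def * vec_eq_iff forall_3
    by (simp add: control_torque_def algebra_simps)
qed

theorem proposition3:
  fixes P :: quadcopter
    and T :: "real set"
    and b v \<Omega> :: "real \<Rightarrow> real^3"
    and R :: "real \<Rightarrow> real^3^3"
    and \<omega> u :: "nat \<Rightarrow> real \<Rightarrow> real"
  assumes "admissible P"
    and "is_interval T"
    and "\<And>t. t \<in> T \<Longrightarrow> (b t, R t, v t, \<Omega> t) \<in> phase_space"
    and "\<And>i t. i \<in> {1..4} \<Longrightarrow> t \<in> T \<Longrightarrow> u i t = (\<omega> i t)\<^sup>2"
  shows "\<forall>t\<in>T. no_gyro_motion_eqs_at P T b R v \<Omega> \<omega> t \<longleftrightarrow>
           affine_control_system_at (drift_field P) (control_field P) T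
             (\<lambda>s. (b s, R s, v s, \<Omega> s)) u t"
proof
  fix t assume "t \<in> T"
  let ?J = "inertia_tensor P" and ?w = "\<lambda>i. \<omega> i t"
  let ?\<alpha> = "cross3 (v t) (\<Omega> t) + inverse (mass P) *\<^sub>R drag_force P (v t)
    + inverse (mass P) *\<^sub>R gravity_force P (R t) + inverse (mass P) *\<^sub>R thrust_force P ?w"
  let ?\<beta> = "matrix_inv ?J *v cross3 (?J *v \<Omega> t) (\<Omega> t) + matrix_inv ?J *v drag_torque P (\<Omega> t)
    + matrix_inv ?J *v rotor_torque P ?w"
  have m: "mass P \<noteq> 0" and "\<And>k. inertia P $ k \<noteq> 0"
    using \<open>admissible P\<close> by (auto simp: admissible_def less_le)
  then have J: "invertible ?J"
    unfolding inertia_tensor_def by (intro invertible_diag_matrix)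
  \<comment> \<open>The force balance determines the acceleration uniquely, so the existential over
    \<open>v'\<close> in \<open>motion_eqs_at\<close> collapses to one explicit derivative.\<close>
  have "mass P *\<^sub>R v' = cross3 (mass P *\<^sub>R v t) (\<Omega> t) + drag_force P (v t)
      + gravity_force P (R t) + thrust_force P ?w \<longleftrightarrow> v' = ?\<alpha>" for v'
  proof -
    have "mass P *\<^sub>R ?\<alpha> = cross3 (mass P *\<^sub>R v t) (\<Omega> t) + drag_force P (v t)
        + gravity_force P (R t) + thrust_force P ?w"
      using m by (simp add: scaleR_add_right cross_mult_left)
    then show ?thesis
      using m scaleR_cancel_left [of "mass P" v' ?\<alpha>] by simp
  qed
  \<comment> \<open>The trailing \<open>+ 0\<close> is the suppressed gyroscopic torque, kept so
    that the equation matches the unfolded definition.\<close>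
  moreover have "?J *v \<Omega>' = cross3 (?J *v \<Omega> t) (\<Omega> t) + rotor_torque P ?w
      + drag_torque P (\<Omega> t) + 0 \<longleftrightarrow> \<Omega>' = ?\<beta>" for \<Omega>'
    unfolding matrix_vector_mult_eq_iff [OF J]
    by (simp add: matrix_vector_right_distrib ac_simps)
  ultimately have motion: "no_gyro_motion_eqs_at P T b R v \<Omega> \<omega> t \<longleftrightarrow>
      (b has_vector_derivative R t *v v t) (at t within T) \<and>
      (R has_vector_derivative R t ** hat (\<Omega> t)) (at t within T) \<and>
      (v has_vector_derivative ?\<alpha>) (at t within T) \<and>
      (\<Omega> has_vector_derivative ?\<beta>) (at t within T)"
    unfolding motion_eqs_at_def by simp
  have "(\<Sum>i = 1..4. u i t *\<^sub>R control_field P i (b t, R t, v t, \<Omega> t)) =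
      (\<Sum>i = 1..4. (?w i)\<^sup>2 *\<^sub>R control_field P i (b t, R t, v t, \<Omega> t))"
    using assms(4) \<open>t \<in> T\<close> by (intro sum.cong) auto
  \<comment> \<open>The inputs leave the kinematic blocks alone, and linearity moves
    \<open>matrix_inv ?J\<close> out of the sum.\<close>
  also have "\<dots> = (0, 0, inverse (mass P) *\<^sub>R thrust_force P ?w,
      matrix_inv ?J *v rotor_torque P ?w)"
    by (simp add: control_field_def thrust_force_eq_sum rotor_torque_eq_sum prod_eq_iff
        fst_sum snd_sum linear_sum [OF matrix_vector_mul_linear] matrix_vector_mult_scaleR)
  finally have "affine_control_system_at (drift_field P) (control_field P) T
      (\<lambda>s. (b s, R s, v s, \<Omega> s)) u t \<longleftrightarrow>
      ((\<lambda>s. (b s, R s, v s, \<Omega> s)) has_vector_derivative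
        (R t *v v t, R t ** hat (\<Omega> t), ?\<alpha>, ?\<beta>)) (at t within T)"
    by (simp add: affine_control_system_at_def)
  \<comment> \<open>A curve of nested pairs has a given derivative exactly when each of its four
    components does.\<close>
  with motion show "no_gyro_motion_eqs_at P T b R v \<Omega> \<omega> t \<longleftrightarrow>
      affine_control_system_at (drift_field P) (control_field P) T
        (\<lambda>s. (b s, R s, v s, \<Omega> s)) u t"
    by (simp only: has_vector_derivative_Pair_iff)
qed

end
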